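(* For each ordinal $1\le\alpha<\omega_1$, the spaces $c_{0,P_\alpha}$ and $c_{0,Q_\alpha}$ are not Grothendieck spaces.
   Context: An ideal on a countable set $S$ is a collection of subsets of $S$ containing $\emptyset$ and all finite subsets of $S$, closed under taking subsets and finite unions (it need not be proper). For an ideal $\mathcal I$ on $\mathbb N$, $c_{0,\mathcal I}$ is the space of $(x_n)\in\ell_\infty$ (bounded real sequences) such that $\{n:|x_n|\ge\varepsilon\}\in\mathcal I$ for every $\varepsilon>0$, with the sup norm. The orthogonal is $\mathcal I^\perp=\{B\subseteq\mathbb N:A\cap B\text{ is finite for all }A\in\mathcal I\}$. For ideals $\mathcal I_n$ on $\mathbb N$, $\bigoplus_n\mathcal I_n$ is the ideal on $\mathbb N$ obtained by taking a partition $\{K_n:n\in\mathbb N\}$ of $\mathbb N$ into infinite sets, an isomorphic copy $\mathcal I_n'$ of $\mathcal I_n$ on $K_n$ (via a bijection), and putting $A\in\bigoplus_n\mathcal I_n$ iff $A\cap K_n\in\mathcal I_n'$ for all $n$; up to isomorphism it does not depend on the choices. $\mathcal I^\omega$ is $\bigoplus_n\mathcal I_n$ with all $\mathcal I_n=\mathcal I$. For every limit ordinal $\alpha<\omega_1$ fix an increasing sequence $(\upsilon_n^\alpha)_n$ of ordinals with $\sup_n\upsilon_n^\alpha=\alpha$. The ideals $P_\alpha,Q_\alpha$ ($\alpha<\omega_1$) on $\mathbb N$ are defined recursively by: $P_0=\mathcal P(\mathbb N)$; $P_{\alpha+1}=(P_\alpha^\perp)^\omega$; $P_\alpha=\bigoplus_n(P_{\upsilon_n^\alpha})^\perp$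 for $\alpha$ limit; and $Q_\alpha=(P_\alpha)^\perp$ for every $\alpha<\omega_1$ (so $Q_0$ is the ideal of finite sets). A Banach space $X$ is Grothendieck if every bounded linear operator from $X$ to $c_0$ is weakly compact. *)

theory Defs
  imports "HOL-Analysis.Analysis"
begin

subsection \<open>The countable ordinals\<close>

text \<open>The well-order \<^term>\<open>cardSuc natLeq\<close> has order type the first uncountable ordinal, so the
  elements of its field represent the ordinals \<open>\<alpha> < \<omega>\<^sub>1\<close>; see \<open>countable_below\<close> and
  \<open>uncountable_omega1\<close>.\<close>

lemma omega1_Card_order: "Card_order (cardSuc natLeq)"
  by (rule cardSuc_Card_order[OF natLeq_Card_order])

lemma omega1_Well_order: "Well_order (cardSuc natLeq)"
  using omega1_Card_order card_order_on_well_order_on by blast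

lemma infinite_omega1_Field: "infinite (Field (cardSuc natLeq))"
  using cardSuc_finite[OF natLeq_Card_order] by (simp add: Field_natLeq)

typedef omega1 = "Field (cardSuc natLeq)"
  using infinite_omega1_Field by (metis ex_in_conv finite.emptyI)

instantiation omega1 :: linorder
begin

definition less_eq_omega1 :: "omega1 \<Rightarrow> omega1 \<Rightarrow> bool" where
  "\<alpha> \<le> \<beta> \<longleftrightarrow> (Rep_omega1 \<alpha>, Rep_omega1 \<beta>) \<in> cardSuc natLeq"

definition less_omega1 :: "omega1 \<Rightarrow> omega1 \<Rightarrow> bool" where
  "\<alpha> < \<beta> \<longleftrightarrow> \<alpha> \<le> \<beta> \<and> \<alpha> \<noteq> (\<beta> :: omega1)"

instance
proof -
  have lin: "Refl (cardSuc natLeq)" "trans (cardSuc natLeq)"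
    "antisym (cardSuc natLeq)" "Total (cardSuc natLeq)"
    using omega1_Well_order
    by (auto simp: well_order_on_def linear_order_on_def partial_order_on_def preorder_on_def)
  have refl: "\<alpha> \<le> \<alpha>" for \<alpha> :: omega1
    using lin(1) Rep_omega1 by (auto simp: less_eq_omega1_def refl_on_def)
  have anti: "\<alpha> \<le> \<beta> \<Longrightarrow> \<beta> \<le> \<alpha> \<Longrightarrow> \<alpha> = \<beta>" for \<alpha> \<beta> :: omega1
    using antisymD[OF lin(3)] Rep_omega1_inject[THEN iffD1] unfolding less_eq_omega1_def by metis
  show "OFCLASS(omega1, linorder_class)"
  proof
    fix \<alpha> \<beta> \<gamma> :: omega1
    show "\<alpha> \<le> \<alpha>" by (rule refl)
    show "\<alpha> \<le> \<beta> \<Longrightarrow> \<beta> \<le> \<alpha> \<Longrightarrow> \<alpha> = \<beta>" by (rule anti)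
    show "(\<alpha> < \<beta>) = (\<alpha> \<le> \<beta> \<and> \<not> \<beta> \<le> \<alpha>)"
      using refl anti by (auto simp: less_omega1_def)
    show "\<alpha> \<le> \<beta> \<Longrightarrow> \<beta> \<le> \<gamma> \<Longrightarrow> \<alpha> \<le> \<gamma>"
      using lin(2) by (auto simp: less_eq_omega1_def trans_def)
    show "\<alpha> \<le> \<beta> \<or> \<beta> \<le> \<alpha>"
      using lin(4) Rep_omega1[of \<alpha>] Rep_omega1[of \<beta>] refl
      by (cases "\<alpha> = \<beta>") (auto simp: less_eq_omega1_def total_on_def Rep_omega1_inject)
  qed
qed

end

lemma wf_less_omega1: "wf {(\<alpha>, \<beta> :: omega1). \<alpha> < \<beta>}"
proof -
  have "wf (cardSuc natLeq - Id)"
    using omega1_Well_order by (simp add: well_order_on_def)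
  then have "wf (inv_image (cardSuc natLeq - Id) Rep_omega1)"
    by (rule wf_inv_image)
  moreover have "{(\<alpha>, \<beta>). \<alpha> < \<beta>} = inv_image (cardSuc natLeq - Id) Rep_omega1"
    by (auto simp: less_omega1_def less_eq_omega1_def Rep_omega1_inject)
  ultimately show ?thesis by simp
qed

instance omega1 :: wellorder
  by (rule wf_wellorderI[OF wf_less_omega1]) intro_classes

lemma countable_below:
  includes cardinal_syntax
  shows "countable {..<\<alpha> :: omega1}"
proof -
  let ?U = "underS (cardSuc natLeq) (Rep_omega1 \<alpha>)"
  have "|?U| <o cardSuc natLeq"
    by (rule card_of_underS[OF omega1_Card_order Rep_omega1])
  then have "|?U| \<le>o natLeq"
    using cardSuc_ordLeq_ordLess[OF natLeq_Card_order card_of_Card_order] by blast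
  then have "|?U| \<le>o |UNIV :: nat set|"
    using card_of_nat ordIso_symmetric ordLeq_ordIso_trans by blast
  then obtain h :: "_ \<Rightarrow> nat" where "inj_on h ?U"
    unfolding card_of_ordLeq[symmetric] by blast
  then have "countable ?U" by (rule countableI)
  moreover have "Rep_omega1 ` {..<\<alpha>} \<subseteq> ?U"
    by (auto simp: underS_def less_omega1_def less_eq_omega1_def Rep_omega1_inject)
  ultimately have "countable (Rep_omega1 ` {..<\<alpha>})"
    by (rule countable_subset[rotated])
  then show ?thesis
    by (rule countable_image_inj_on) (simp add: inj_on_def Rep_omega1_inject)
qed

lemma uncountable_omega1:
  includes cardinal_syntax
  shows "uncountable (UNIV :: omega1 set)"
proof
  assume "countable (UNIV :: omega1 set)"
  then have "countable (range Rep_omega1)" by simp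
  then have "countable (Field (cardSuc natLeq))"
    using type_definition.Rep_range[OF type_definition_omega1] by simp
  then obtain h :: "_ \<Rightarrow> nat" where "inj_on h (Field (cardSuc natLeq))"
    by (auto simp: countable_def)
  then have "|Field (cardSuc natLeq)| \<le>o |UNIV :: nat set|"
    unfolding card_of_ordLeq[symmetric] by blast
  then have "|Field (cardSuc natLeq)| \<le>o natLeq"
    using card_of_nat ordLeq_ordIso_trans by blast
  then have "cardSuc natLeq \<le>o natLeq"
    using card_of_Field_ordIso[OF omega1_Card_order] ordIso_symmetric ordIso_ordLeq_trans by blast
  then show False
    using cardSuc_greater[OF natLeq_Card_order] not_ordLess_ordLeq by blast
qed

lemma omega1_no_greatest: "\<exists>\<beta>. \<alpha> < (\<beta> :: omega1)"
proof (rule ccontr)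
  assume "\<nexists>\<beta>. \<alpha> < \<beta>"
  then have "UNIV = insert \<alpha> {..<\<alpha>}"
    by (auto simp: not_less) (metis le_less)
  then have "countable (UNIV :: omega1 set)"
    using countable_below[of \<alpha>] by (metis countable_insert)
  then show False using uncountable_omega1 by blast
qed

definition osuc :: "omega1 \<Rightarrow> omega1" where
  "osuc \<alpha> = (LEAST \<beta>. \<alpha> < \<beta>)"

instantiation omega1 :: "{zero, one}"
begin

definition zero_omega1 :: omega1 where
  "0 = (LEAST \<alpha> :: omega1. True)"

definition one_omega1 :: omega1 where
  "1 = osuc 0"

instance ..

end

definition is_limit :: "omega1 \<Rightarrow> bool" where
  "is_limit \<alpha> \<longleftrightarrow> \<alpha> \<noteq> 0 \<and> (\<forall>\<beta>. \<alpha> \<noteq> osuc \<beta>)"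

lemma less_osuc: "\<alpha> < osuc \<alpha>"
  unfolding osuc_def using omega1_no_greatest by (rule LeastI_ex)

lemma osuc_least: "\<alpha> < \<beta> \<Longrightarrow> osuc \<alpha> \<le> \<beta>"
  unfolding osuc_def by (rule Least_le)

lemma zero_le_omega1: "0 \<le> (\<alpha> :: omega1)"
  unfolding zero_omega1_def by (rule Least_le) simp

lemma osuc_neq_zero: "osuc \<alpha> \<noteq> 0"
  using less_osuc[of \<alpha>] zero_le_omega1[of \<alpha>] by auto

lemma osuc_inject: "osuc \<alpha> = osuc \<beta> \<longleftrightarrow> \<alpha> = \<beta>"
  by (metis less_osuc osuc_least not_less neq_iff)


subsection \<open>Ideals and the families \<open>P\<^sub>\<alpha>\<close>, \<open>Q\<^sub>\<alpha>\<close>\<close>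

definition is_ideal :: "nat set set \<Rightarrow> bool" where
  "is_ideal I \<longleftrightarrow>
     (\<forall>A. finite A \<longrightarrow> A \<in> I) \<and>
     (\<forall>A\<in>I. \<forall>B\<subseteq>A. B \<in> I) \<and>
     (\<forall>A\<in>I. \<forall>B\<in>I. A \<union> B \<in> I)"

definition orth :: "nat set set \<Rightarrow> nat set set" where
  "orth I = {B. \<forall>A\<in>I. finite (A \<inter> B)}"

text \<open>The data on which a direct sum depends: a partition of \<open>\<nat>\<close> into infinite pieces \<open>K n\<close>,
  and bijections \<open>g n\<close> from \<open>\<nat>\<close> onto \<open>K n\<close>.\<close>

definition sum_data :: "(nat \<Rightarrow> nat set) \<Rightarrow> (nat \<Rightarrow> nat \<Rightarrow> nat) \<Rightarrow> bool" where
  "sum_data K g \<longleftrightarrow>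
     (\<forall>n. infinite (K n)) \<and> disjoint_family K \<and> (\<Union>n. K n) = UNIV \<and>
     (\<forall>n. bij_betw (g n) UNIV (K n))"

definition direct_sum ::
  "(nat \<Rightarrow> nat set) \<Rightarrow> (nat \<Rightarrow> nat \<Rightarrow> nat) \<Rightarrow> (nat \<Rightarrow> nat set set) \<Rightarrow> nat set set" where
  "direct_sum K g I = {A. \<forall>n. A \<inter> K n \<in> (\<lambda>B. g n ` B) ` I n}"

text \<open>The choices made in the construction are parameters: \<open>\<upsilon> \<alpha>\<close> is the sequence fixed for the
  limit ordinal \<open>\<alpha>\<close>, and \<open>K \<alpha>\<close>, \<open>g \<alpha>\<close> are the partition and the bijections used for the direct
  sum that defines \<open>P\<^sub>\<alpha>\<close>. The values of \<open>\<upsilon>\<close> at ordinals that are not limits are irrelevant.\<close>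

locale PQ_choices =
  fixes \<upsilon> :: "omega1 \<Rightarrow> nat \<Rightarrow> omega1"
    and K :: "omega1 \<Rightarrow> nat \<Rightarrow> nat set"
    and g :: "omega1 \<Rightarrow> nat \<Rightarrow> nat \<Rightarrow> nat"
  assumes strict_mono_upsilon: "is_limit \<alpha> \<Longrightarrow> strict_mono (\<upsilon> \<alpha>)"
    and upsilon_le: "is_limit \<alpha> \<Longrightarrow> \<upsilon> \<alpha> n \<le> \<alpha>"
    and upsilon_least: "is_limit \<alpha> \<Longrightarrow> (\<And>n. \<upsilon> \<alpha> n \<le> \<beta>) \<Longrightarrow> \<alpha> \<le> \<beta>"
    and sum_data: "sum_data (K \<alpha>) (g \<alpha>)"
begin

lemma upsilon_less: "is_limit \<alpha> \<Longrightarrow> \<upsilon> \<alpha> n < \<alpha>"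
  using strict_monoD[OF strict_mono_upsilon, of \<alpha> n "Suc n"] upsilon_le[of \<alpha> "Suc n"] by simp

function P :: "omega1 \<Rightarrow> nat set set" where
  "P 0 = UNIV"
| "P (osuc \<alpha>) = direct_sum (K (osuc \<alpha>)) (g (osuc \<alpha>)) (\<lambda>_. orth (P \<alpha>))"
| "is_limit \<alpha> \<Longrightarrow> P \<alpha> = direct_sum (K \<alpha>) (g \<alpha>) (\<lambda>n. orth (P (\<upsilon> \<alpha> n)))"
  by (metis is_limit_def) (auto simp: is_limit_def osuc_neq_zero osuc_inject dest: sym)
termination
  by (relation "{(\<alpha>, \<beta>). \<alpha> < \<beta>}") (auto simp: wf_less_omega1 less_osuc upsilon_less)

definition Q :: "omega1 \<Rightarrow> nat set set" where
  "Q \<alpha> = orth (P \<alpha>)"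

end


subsection \<open>The spaces \<open>c\<^sub>0\<^sub>,\<^sub>I\<close>\<close>

text \<open>Since \<open>\<nat>\<close> is discrete, \<^typ>\<open>nat \<Rightarrow>\<^sub>C real\<close> is \<open>\<ell>\<^sub>\<infinity>\<close> with the sup norm. Subspaces of it are
  represented as sets with the inherited operations and norm.\<close>

definition c0_ideal :: "nat set set \<Rightarrow> (nat \<Rightarrow>\<^sub>C real) set" where
  "c0_ideal I = {x. \<forall>\<epsilon>>0. {n. \<bar>apply_bcontfun x n\<bar> \<ge> \<epsilon>} \<in> I}"

definition c0 :: "(nat \<Rightarrow>\<^sub>C real) set" where
  "c0 = {x. apply_bcontfun x \<longlonglongrightarrow> 0}"


subsection \<open>Weak compactness and Grothendieck spaces\<close>

text \<open>Normed spaces are given as linear subspaces \<open>X\<close>, \<open>Y\<close> of a normed type. An operator is a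
  function on the whole type of which only the restriction to \<open>X\<close> matters.\<close>

definition bounded_operator ::
  "'a::real_normed_vector set \<Rightarrow> 'b::real_normed_vector set \<Rightarrow> ('a \<Rightarrow> 'b) \<Rightarrow> bool" where
  "bounded_operator X Y T \<longleftrightarrow>
     (\<forall>x\<in>X. T x \<in> Y) \<and>
     (\<forall>x\<in>X. \<forall>y\<in>X. T (x + y) = T x + T y) \<and>
     (\<forall>c. \<forall>x\<in>X. T (c *\<^sub>R x) = c *\<^sub>R T x) \<and>
     (\<exists>B. \<forall>x\<in>X. norm (T x) \<le> B * norm x)"

definition weak_topology :: "'a::real_normed_vector set \<Rightarrow> 'a topology" where
  "weak_topology X = topology_generated_by
     {{x \<in> X. f x \<in> U} | f (U :: real set). bounded_operator X UNIV f \<and> open U}"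

lemma topspace_weak_topology: "topspace (weak_topology X) = X"
proof -
  have "bounded_operator X UNIV (\<lambda>_. 0 :: real)"
    by (auto simp: bounded_operator_def intro!: exI[of _ 0])
  then have "\<exists>f (U :: real set). X = {x \<in> X. f x \<in> U} \<and> bounded_operator X UNIV f \<and> open U"
    by (intro exI[of _ "\<lambda>_. 0"] exI[of _ UNIV]) auto
  then show ?thesis
    unfolding weak_topology_def topology_generated_by_topspace by blast
qed

text \<open>The image of the closed unit ball is relatively compact in the weak topology.\<close>

definition weakly_compact_operator ::
  "'a::real_normed_vector set \<Rightarrow> 'b::real_normed_vector set \<Rightarrow> ('a \<Rightarrow> 'b) \<Rightarrow> bool" where
  "weakly_compact_operator X Y T \<longleftrightarrow>
     compactin (weak_topology Y) (weak_topology Y closure_of (T ` (X \<inter> cball 0 1)))"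

definition grothendieck :: "'a::real_normed_vector set \<Rightarrow> bool" where
  "grothendieck X \<longleftrightarrow>
     (\<forall>T. bounded_operator X c0 T \<longrightarrow> weakly_compact_operator X c0 T)"

text \<open>For every ideal \<open>I\<close> the set \<^term>\<open>c0_ideal I\<close> is a Banach space, as it is a closed subspace
  of \<open>\<ell>\<^sub>\<infinity>\<close>; and \<open>c\<^sub>0\<close> is the case of the ideal of finite sets.\<close>

lemma subspace_c0_ideal:
  assumes "is_ideal I"
  shows "subspace (c0_ideal I)"
proof (rule subspaceI)
  have fin: "\<And>A. finite A \<Longrightarrow> A \<in> I" and sub: "\<And>A B. A \<in> I \<Longrightarrow> B \<subseteq> A \<Longrightarrow> B \<in> I"
    and un: "\<And>A B. A \<in> I \<Longrightarrow> B \<in> I \<Longrightarrow> A \<union> B \<in> I"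
    using assms by (auto simp: is_ideal_def)
  show "0 \<in> c0_ideal I"
    using fin[of "{}"] by (auto simp: c0_ideal_def not_le)
  show "x + y \<in> c0_ideal I" if "x \<in> c0_ideal I" "y \<in> c0_ideal I" for x y
    unfolding c0_ideal_def
  proof (intro CollectI allI impI)
    fix \<epsilon> :: real assume "\<epsilon> > 0"
    then have "{n. \<bar>x n\<bar> \<ge> \<epsilon> / 2} \<union> {n. \<bar>y n\<bar> \<ge> \<epsilon> / 2} \<in> I"
      using that un half_gt_zero unfolding c0_ideal_def by blast
    then show "{n. \<bar>(x + y) n\<bar> \<ge> \<epsilon>} \<in> I"
      by (rule sub) (auto simp: abs_le_iff abs_if split: if_splits)
  qed
  show "c *\<^sub>R x \<in> c0_ideal I" if "x \<in> c0_ideal I" for c x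
    unfolding c0_ideal_def
  proof (intro CollectI allI impI)
    fix \<epsilon> :: real assume "\<epsilon> > 0"
    show "{n. \<bar>(c *\<^sub>R x) n\<bar> \<ge> \<epsilon>} \<in> I"
    proof (cases "c = 0")
      case True
      then show ?thesis using fin[of "{}"] \<open>\<epsilon> > 0\<close> by (simp add: not_le)
    next
      case False
      then have "\<epsilon> / \<bar>c\<bar> > 0" using \<open>\<epsilon> > 0\<close> by simp
      then have "{n. \<bar>x n\<bar> \<ge> \<epsilon> / \<bar>c\<bar>} \<in> I"
        using that unfolding c0_ideal_def by blast
      then show ?thesis
        by (rule sub) (use False in \<open>auto simp: abs_mult field_simps\<close>)
    qed
  qed
qed

lemma closed_c0_ideal:
  assumes "is_ideal I"
  shows "closed (c0_ideal I)"
proof -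
  have sub: "\<And>A B. A \<in> I \<Longrightarrow> B \<subseteq> A \<Longrightarrow> B \<in> I"
    using assms by (auto simp: is_ideal_def)
  have "x \<in> c0_ideal I" if lim: "\<forall>e>0. \<exists>y\<in>c0_ideal I. dist y x < e" for x
    unfolding c0_ideal_def
  proof (intro CollectI allI impI)
    fix \<epsilon> :: real assume "\<epsilon> > 0"
    then obtain y where y: "y \<in> c0_ideal I" "dist y x < \<epsilon> / 2"
      using lim half_gt_zero by blast
    then have "{n. \<bar>y n\<bar> \<ge> \<epsilon> / 2} \<in> I"
      using half_gt_zero[OF \<open>\<epsilon> > 0\<close>] unfolding c0_ideal_def by blast
    moreover have lt: "\<bar>y n - x n\<bar> < \<epsilon> / 2" for n
      using dist_bounded[of y n x] y(2) by (simp add: dist_real_def)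
    have "\<bar>y n\<bar> \<ge> \<epsilon> / 2" if "\<bar>x n\<bar> \<ge> \<epsilon>" for n
      using that lt[of n] by linarith
    then have "{n. \<bar>x n\<bar> \<ge> \<epsilon>} \<subseteq> {n. \<bar>y n\<bar> \<ge> \<epsilon> / 2}" by blast
    ultimately show "{n. \<bar>x n\<bar> \<ge> \<epsilon>} \<in> I" by (rule sub)
  qed
  then show ?thesis
    by (auto simp: closed_limpt islimpt_approachable) (metis)
qed

lemma c0_eq_c0_ideal: "c0 = c0_ideal {A. finite A}"
proof -
  have "apply_bcontfun x \<longlonglongrightarrow> 0 \<longleftrightarrow> (\<forall>\<epsilon>>0. finite {n. \<bar>x n\<bar> \<ge> \<epsilon>})" for x :: "nat \<Rightarrow>\<^sub>C real"
    by (simp add: tendsto_iff dist_real_def cofinite_eq_sequentially[symmetric]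
        eventually_cofinite not_less)
  then show ?thesis by (auto simp: c0_def c0_ideal_def)
qed

lemma is_ideal_orth: "is_ideal (orth I)"
  unfolding is_ideal_def orth_def
  by (auto simp: Int_Un_distrib) (metis Int_mono finite_subset order_refl)

lemma is_ideal_direct_sum:
  assumes "sum_data K g" "\<And>n. is_ideal (I n)"
  shows "is_ideal (direct_sum K g I)"
proof -
  have K: "K n = range (g n)" and inj: "inj (g n)" for n
    using assms(1) by (auto simp: sum_data_def bij_betw_def)
  have "A \<inter> K n \<in> (\<lambda>B. g n ` B) ` I n \<longleftrightarrow> g n -` A \<in> I n" for A n
  proof
    assume "A \<inter> K n \<in> (\<lambda>B. g n ` B) ` I n"
    then obtain B where B: "B \<in> I n" "A \<inter> K n = g n ` B" by blast
    have "g n -` A = g n -` (A \<inter> K n)" unfolding K by auto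
    then have "g n -` A = g n -` (g n ` B)" unfolding B(2) .
    then show "g n -` A \<in> I n" using inj B(1) by (simp add: inj_vimage_image_eq)
  next
    assume "g n -` A \<in> I n"
    moreover have "A \<inter> K n = g n ` (g n -` A)" unfolding K by auto
    ultimately show "A \<inter> K n \<in> (\<lambda>B. g n ` B) ` I n" by blast
  qed
  then have eq: "direct_sum K g I = {A. \<forall>n. g n -` A \<in> I n}"
    by (simp add: direct_sum_def)
  have fin: "\<And>A n. finite A \<Longrightarrow> A \<in> I n"
    and sub: "\<And>A B n. A \<in> I n \<Longrightarrow> B \<subseteq> A \<Longrightarrow> B \<in> I n"
    and un: "\<And>A B n. A \<in> I n \<Longrightarrow> B \<in> I n \<Longrightarrow> A \<union> B \<in> I n"
    using assms(2) by (auto simp: is_ideal_def)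
  show ?thesis
    unfolding is_ideal_def eq
  proof (intro conjI allI ballI impI CollectI)
    show "g n -` A \<in> I n" if "finite A" for A n
      by (rule fin, rule finite_vimageI[OF that inj])
    show "g n -` B \<in> I n" if "A \<in> {A. \<forall>n. g n -` A \<in> I n}" "B \<subseteq> A" for A B n
      by (rule sub[of "g n -` A"]) (use that in auto)
    show "g n -` (A \<union> B) \<in> I n"
      if "A \<in> {A. \<forall>n. g n -` A \<in> I n}" "B \<in> {A. \<forall>n. g n -` A \<in> I n}" for A B n
      unfolding vimage_Un by (rule un) (use that in auto)
  qed
qed

lemma (in PQ_choices) is_ideal_P: "is_ideal (P \<alpha>)"
proof -
  consider "\<alpha> = 0" | \<beta> where "\<alpha> = osuc \<beta>" | "is_limit \<alpha>"
    by (metis is_limit_def)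
  then show ?thesis
    by cases (simp_all add: is_ideal_direct_sum sum_data is_ideal_orth, simp add: is_ideal_def)
qed

lemma (in PQ_choices) is_ideal_Q: "is_ideal (Q \<alpha>)"
  by (simp add: Q_def is_ideal_orth)

end

theory Submission
  imports Defs
begin

text \<open>If \<open>I\<^sup>\<bottom>\<close> contains an infinite set \<open>B\<close>, then restriction to \<open>B\<close> is an operator from \<open>c\<^sub>0\<^sub>,\<^sub>I\<close>
  to \<open>c\<^sub>0(B)\<close> that maps the unit ball onto the unit ball of \<open>c\<^sub>0(B)\<close>, so it is not weakly compact.
  Each \<open>P\<^sub>\<alpha>\<close> contains an infinite set: for \<open>\<alpha> \<ge> 1\<close> a selector of the partition. It lies in
  \<open>P\<^sub>\<alpha>\<^sup>\<bottom>\<^sup>\<bottom> = Q\<^sub>\<alpha>\<^sup>\<bottom>\<close>. If \<open>\<alpha> \<ge> 1\<close>, the first summand of \<open>P\<^sub>\<alpha>\<close> is a copy of some \<open>P\<^sub>\<beta>\<^sup>\<bottom>\<close>, and so the copy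
  in \<open>K\<^sub>0\<close> of an infinite element of \<open>P\<^sub>\<beta>\<close> belongs to \<open>P\<^sub>\<alpha>\<^sup>\<bottom>\<close>.\<close>

lemma bcontfun_discrete_iff:
  fixes f :: "'a::discrete_topology \<Rightarrow> 'b::metric_space"
  shows "f \<in> bcontfun \<longleftrightarrow> bounded (range f)"
  by (simp add: bcontfun_def continuous_on_discrete)

lemma apply_bcontfun_reindex:
  fixes x :: "'b::discrete_topology \<Rightarrow>\<^sub>C 'c::metric_space" and b :: "'a::discrete_topology \<Rightarrow> 'b"
  shows "apply_bcontfun (Bcontfun (\<lambda>n. x (b n))) = (\<lambda>n. x (b n))"
proof -
  have "bounded (range (\<lambda>n. x (b n)))"
    using apply_bcontfun[of x] by (auto simp: bcontfun_discrete_iff intro: bounded_subset)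
  then show ?thesis by (simp add: Bcontfun_inverse bcontfun_discrete_iff)
qed

lemma apply_bcontfun_indicator:
  fixes A :: "'a::discrete_topology set"
  shows "apply_bcontfun (Bcontfun (indicator A :: 'a \<Rightarrow> real)) = indicator A"
proof -
  have "range (indicator A :: 'a \<Rightarrow> real) \<subseteq> {0, 1}" by (auto simp: indicator_def)
  then have "bounded (range (indicator A :: 'a \<Rightarrow> real))"
    by (rule bounded_subset[rotated]) simp
  then show ?thesis by (simp add: Bcontfun_inverse bcontfun_discrete_iff)
qed

lemma openin_weak_topology_vimage:
  assumes "bounded_operator X UNIV f" "open (U :: real set)"
  shows "openin (weak_topology X) {x \<in> X. f x \<in> U}"
  unfolding weak_topology_def using assms by (intro topology_generated_by_Basis) blast

text \<open>As |x n| \<le> norm x, coordinates are bounded functionals, so an open condition on one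
  coordinate is weakly open.\<close>

lemma bounded_operator_eval: "bounded_operator X UNIV (\<lambda>x :: 'a::topological_space \<Rightarrow>\<^sub>C real. x n)"
  unfolding bounded_operator_def
  using norm_bounded[where x = n] by (auto simp flip: real_norm_def intro!: exI[of _ 1])

text \<open>The sets \<open>{x. x n \<noteq> 1}\<close> are a weakly open cover of \<open>c\<^sub>0\<close>.\<close>
lemma not_weakly_compact_operator_c0:
  assumes "bounded_operator X c0 T"
    and initial: "\<And>N. \<exists>x\<in>X. norm x \<le> 1 \<and> (\<forall>n<N. T x n = 1)"
  shows "\<not> weakly_compact_operator X c0 T"
proof
  let ?C = "weak_topology c0 closure_of (T ` (X \<inter> cball 0 1))"
  define U where "U n = {x \<in> c0. x n \<in> - {1}}" for n
  assume "weakly_compact_operator X c0 T"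
  then have compact: "compactin (weak_topology c0) ?C"
    by (simp add: weakly_compact_operator_def)
  have "openin (weak_topology c0) (U n)" for n
    unfolding U_def by (rule openin_weak_topology_vimage[OF bounded_operator_eval open_Compl[OF closed_singleton]])
  moreover have "c0 \<subseteq> (\<Union>n. U n)"
  proof
    fix x assume x: "x \<in> c0"
    \<comment> \<open>Otherwise \<open>x\<close> is the constant 1, which does not tend to
      0.\<close>
    have "\<exists>n. x n \<noteq> 1"
    proof (rule ccontr)
      assume "\<nexists>n. x n \<noteq> 1"
      then have "apply_bcontfun x = (\<lambda>_. 1)" by auto
      then show False using x by (simp add: c0_def LIMSEQ_const_iff)
    qed
    then show "x \<in> (\<Union>n. U n)" using x by (auto simp: U_def)
  qed
  then have "?C \<subseteq> (\<Union>n. U n)"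
    using closure_of_subset_topspace[of "weak_topology c0"] unfolding topspace_weak_topology
    by (rule order_trans[rotated])
  ultimately have "\<exists>\<F>. finite \<F> \<and> \<F> \<subseteq> range U \<and> ?C \<subseteq> \<Union>\<F>"
    by (intro compactinD[OF compact]) auto
  then obtain \<F> where \<F>: "finite \<F>" "\<F> \<subseteq> range U" "?C \<subseteq> \<Union>\<F>" by blast
  obtain F where F: "finite F" "\<F> = U ` F"
    using finite_subset_image[OF \<F>(1,2)] by auto
  \<comment> \<open>Beyond all indices of the finite subcover: an image point with its first
    \<open>N\<close> coordinates equal to 1 escapes every chosen \<open>U n\<close>.\<close>
  obtain N where N: "\<And>n. n \<in> F \<Longrightarrow> n < N"
    using F(1) finite_nat_set_iff_bounded by auto
  obtain x where x: "x \<in> X" "norm x \<le> 1" "\<And>n. n < N \<Longrightarrow> T x n = 1"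
    using initial by blast
  have "T ` (X \<inter> cball 0 1) \<subseteq> ?C"
    using assms(1) by (intro closure_of_subset) (auto simp: topspace_weak_topology bounded_operator_def)
  then have "T x \<in> ?C" using x(1,2) by auto
  then have "T x \<in> \<Union>\<F>" using \<F>(3) by blast
  then obtain n where "n \<in> F" "T x n \<noteq> 1"
    using F(2) by (auto simp: U_def)
  then show False using N x(3) by blast
qed

lemma not_grothendieck_c0_ideal:
  assumes fin: "\<And>A. finite A \<Longrightarrow> A \<in> I" and B: "B \<in> orth I" "infinite B"
  shows "\<not> grothendieck (c0_ideal I)"
proof -
  obtain b :: "nat \<Rightarrow> nat" where b: "inj b" "range b \<subseteq> B"
    using infinite_countable_subset[OF B(2)] by blast
  \<comment> \<open>Restriction to \<open>range b\<close>, reindexed by the naturals so that its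
    values lie in \<open>c0\<close>.\<close>
  define T :: "(nat \<Rightarrow>\<^sub>C real) \<Rightarrow> (nat \<Rightarrow>\<^sub>C real)" where "T x = Bcontfun (\<lambda>n. x (b n))" for x
  have T: "T x n = x (b n)" for x n
    by (simp add: T_def apply_bcontfun_reindex)
  have "T x \<in> c0" if x: "x \<in> c0_ideal I" for x
    unfolding c0_eq_c0_ideal c0_ideal_def
  proof (clarify)
    fix \<epsilon> :: real assume "\<epsilon> > 0"
    \<comment> \<open>The superlevel set belongs to \<open>I\<close> and \<open>B\<close> is
      orthogonal to \<open>I\<close>; injectivity of \<open>b\<close> then transfers finiteness to
      the indices.\<close>
    then have "finite ({n. \<bar>x n\<bar> \<ge> \<epsilon>} \<inter> B)"
      using x B(1) by (auto simp: c0_ideal_def orth_def)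
    then have "finite (b -` ({n. \<bar>x n\<bar> \<ge> \<epsilon>} \<inter> B))"
      using b(1) by (rule finite_vimageI)
    then show "finite {n. \<bar>T x n\<bar> \<ge> \<epsilon>}"
      by (rule finite_subset[rotated]) (use b(2) in \<open>auto simp: T\<close>)
  qed
  moreover have "norm (T x) \<le> 1 * norm x" for x
    by (rule norm_bound) (simp only: T norm_bounded mult_1)
  ultimately have "bounded_operator (c0_ideal I) c0 T"
    unfolding bounded_operator_def by (auto simp: T intro!: bcontfun_eqI exI[of _ 1])
  moreover have "\<exists>x\<in>c0_ideal I. norm x \<le> 1 \<and> (\<forall>n<N. T x n = 1)" for N
  proof (intro bexI conjI allI impI)
    \<comment> \<open>A finitely supported preimage of \<open>N\<close> leading ones; its superlevel
      sets are finite, so \<open>fin\<close> puts it in the space.\<close>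
    let ?x = "Bcontfun (indicator (b ` {..<N}) :: nat \<Rightarrow> real)"
    show "norm ?x \<le> 1"
      by (rule norm_bound) (simp add: apply_bcontfun_indicator indicator_def)
    show "T ?x n = 1" if "n < N" for n
      using that by (simp add: T apply_bcontfun_indicator)
    show "?x \<in> c0_ideal I"
      unfolding c0_ideal_def
    proof (intro CollectI allI impI fin)
      fix \<epsilon> :: real assume "\<epsilon> > 0"
      then have "{n. \<bar>?x n\<bar> \<ge> \<epsilon>} \<subseteq> b ` {..<N}"
        unfolding apply_bcontfun_indicator by (auto simp: indicator_def)
      then show "finite {n. \<bar>?x n\<bar> \<ge> \<epsilon>}"
        by (rule finite_subset) simp
    qed
  qed
  ultimately show ?thesis
    unfolding grothendieck_def using not_weakly_compact_operator_c0 by blast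
qed

lemma subset_orth_orth: "I \<subseteq> orth (orth I)"
  by (auto simp: orth_def Int_commute)

text \<open>The selector picking \<open>g n 0\<close> from each disjoint piece is infinite and meets
  \<open>K n\<close> only in the copy of \<open>{0}\<close>.\<close>

lemma infinite_in_direct_sum:
  assumes "sum_data K g" "\<And>n. {0} \<in> I n"
  shows "\<exists>A\<in>direct_sum K g I. infinite A"
proof
  let ?A = "range (\<lambda>n. g n 0)"
  have mem: "g n m \<in> K n" for n m
    using assms(1) unfolding sum_data_def by (metis bij_betwE UNIV_I)
  have disj: "m = n" if "x \<in> K m" "x \<in> K n" for m n x
    using assms(1) that by (auto simp: sum_data_def disjoint_family_on_def)
  have "inj (\<lambda>n. g n 0)"
    by (rule injI) (metis mem disj)
  then show "infinite ?A" by (rule range_inj_infinite)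
  have "?A \<inter> K n = g n ` {0}" for n
  proof
    show "?A \<inter> K n \<subseteq> g n ` {0}"
      using mem disj by clarify (metis imageI singletonI)
    show "g n ` {0} \<subseteq> ?A \<inter> K n" using mem by blast
  qed
  then show "?A \<in> direct_sum K g I"
    using assms(2) unfolding direct_sum_def by blast
qed

lemma image_in_orth_direct_sum:
  assumes "sum_data K g" "B \<in> orth (I n)"
  shows "g n ` B \<in> orth (direct_sum K g I)"
proof -
  have "inj (g n)" and "range (g n) = K n"
    using assms(1) by (auto simp: sum_data_def bij_betw_def)
  then have sub: "g n ` B \<subseteq> K n" by blast
  have "finite (A \<inter> g n ` B)" if A: "A \<in> direct_sum K g I" for A
  proof -
    obtain C where C: "C \<in> I n" "A \<inter> K n = g n ` C"
      using A unfolding direct_sum_def by blast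
    have "A \<inter> g n ` B = g n ` (C \<inter> B)"
      using sub C(2) image_Int[OF \<open>inj (g n)\<close>] by blast
    then show ?thesis using assms(2) C(1) by (simp add: orth_def)
  qed
  then show ?thesis by (simp add: orth_def)
qed

context PQ_choices
begin

text \<open>Merges the successor and limit clauses, with \<open>\<beta>\<close> constant at a
  successor.\<close>

lemma P_direct_sum:
  assumes "\<alpha> \<noteq> 0"
  obtains \<beta> where "P \<alpha> = direct_sum (K \<alpha>) (g \<alpha>) (\<lambda>n. orth (P (\<beta> n)))"
proof (cases "is_limit \<alpha>")
  case True
  then show thesis by (rule that[OF P.simps(3)])
next
  case False
  then obtain \<gamma> where "\<alpha> = osuc \<gamma>"
    using assms by (auto simp: is_limit_def)
  then show thesis using that[of "\<lambda>_. \<gamma>"] by simp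
qed

lemma infinite_in_P: "\<exists>A\<in>P \<alpha>. infinite A"
proof (cases "\<alpha> = 0")
  case True
  then show ?thesis by (auto intro: infinite_UNIV_nat)
next
  case False
  then obtain \<beta> where "P \<alpha> = direct_sum (K \<alpha>) (g \<alpha>) (\<lambda>n. orth (P (\<beta> n)))"
    by (rule P_direct_sum)
  moreover have "\<exists>A\<in>direct_sum (K \<alpha>) (g \<alpha>) (\<lambda>n. orth (P (\<beta> n))). infinite A"
    by (rule infinite_in_direct_sum[OF sum_data]) (simp add: orth_def)
  ultimately show ?thesis by simp
qed

lemma infinite_in_Q:
  assumes "\<alpha> \<noteq> 0"
  shows "\<exists>A\<in>Q \<alpha>. infinite A"
proof -
  obtain \<beta> where \<beta>: "P \<alpha> = direct_sum (K \<alpha>) (g \<alpha>) (\<lambda>n. orth (P (\<beta> n)))"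
    using assms by (rule P_direct_sum)
  obtain B where B: "B \<in> P (\<beta> 0)" "infinite B"
    using infinite_in_P by blast
  have "g \<alpha> 0 ` B \<in> Q \<alpha>"
    unfolding Q_def \<beta>
    \<comment> \<open>The summand is \<open>orth (P (\<beta> 0))\<close>, so \<open>B\<close> is
      needed in its orthogonal, the double orthogonal of \<open>P (\<beta> 0)\<close>.\<close>
    by (rule image_in_orth_direct_sum[OF sum_data]) (rule subsetD[OF subset_orth_orth B(1)])
  moreover have "inj (g \<alpha> 0)"
    using sum_data[of \<alpha>] by (auto simp: sum_data_def bij_betw_def)
  then have "infinite (g \<alpha> 0 ` B)"
    using B(2) by (simp add: finite_image_iff inj_on_subset)
  ultimately show ?thesis by blast
qed

end

theorem theorem5p19:
  fixes \<upsilon> :: "omega1 \<Rightarrow> nat \<Rightarrow> omega1"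
    and K :: "omega1 \<Rightarrow> nat \<Rightarrow> nat set"
    and g :: "omega1 \<Rightarrow> nat \<Rightarrow> nat \<Rightarrow> nat"
    and \<alpha> :: omega1
  assumes "PQ_choices \<upsilon> K g"
    and "1 \<le> \<alpha>"
  shows "\<not> grothendieck (c0_ideal (PQ_choices.P \<upsilon> K g \<alpha>))
    \<and> \<not> grothendieck (c0_ideal (PQ_choices.Q \<upsilon> K g \<alpha>))"
proof -
  interpret PQ_choices \<upsilon> K g by fact
  have "\<alpha> \<noteq> 0"
    using assms(2) less_osuc[of 0] by (auto simp: one_omega1_def)
  then obtain B where B: "B \<in> orth (P \<alpha>)" "infinite B"
    using infinite_in_Q by (auto simp: Q_def)
  \<comment> \<open>\<open>orth (Q \<alpha>)\<close> is the double orthogonal of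
    \<open>P \<alpha>\<close>, so any infinite member of \<open>P \<alpha>\<close> serves.\<close>
  obtain A where A: "A \<in> orth (Q \<alpha>)" "infinite A"
    using infinite_in_P subset_orth_orth unfolding Q_def by blast
  have "finite C \<Longrightarrow> C \<in> P \<alpha>" "finite C \<Longrightarrow> C \<in> Q \<alpha>" for C
    using is_ideal_P is_ideal_Q by (auto simp: is_ideal_def)
  then show ?thesis
    using not_grothendieck_c0_ideal A B by blast
qed

end
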